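(* Let $a_n$ be the total number of occurrences of the pattern $213$ summed over all permutations of length $n$ that avoid $123$ (with $a_0=0$). Then $$\sum_{n\ge 0} a_n x^n = \frac{x^3 C(x)^3}{(1-4x)^{3/2}} = \frac{x-1}{2(1-4x)} - \frac{3x-1}{2(1-4x)^{3/2}},$$ where $C(x) = \frac{1-\sqrt{1-4x}}{2x}$ is the generating function of the Catalan numbers.
   Context: A permutation $\pi=\pi_1\cdots\pi_n$ avoids $\sigma$ if no subsequence of $\pi$ has the same relative order as $\sigma$. An occurrence of a pattern $\sigma$ of length $k$ in $\pi$ is a set of indices $i_1<\dots<i_k$ such that $\pi_{i_1}\cdots\pi_{i_k}$ has the same relative order as $\sigma$. *)

theory Defs
  imports
    "HOL-Library.Sublist"
    "HOL-Combinatorics.Multiset_Permutations"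
    "HOL-Computational_Algebra.Formal_Power_Series"
begin

text \<open>
  Permutations of length \<open>n\<close> are written in one-line notation, as the lists in
  \<open>permutations_of_set {1..n}\<close>. Positions in a list are counted from 0.
\<close>

definition same_relative_order :: "nat list \<Rightarrow> nat list \<Rightarrow> bool" where
  "same_relative_order xs ys \<longleftrightarrow>
     length xs = length ys \<and>
     (\<forall>i < length xs. \<forall>j < length xs. xs ! i < xs ! j \<longleftrightarrow> ys ! i < ys ! j)"

definition avoids :: "nat list \<Rightarrow> nat list \<Rightarrow> bool" where
  "avoids \<pi> \<sigma> \<longleftrightarrow> \<not> (\<exists>\<tau>. subseq \<tau> \<pi> \<and> same_relative_order \<tau> \<sigma>)"

text \<open>
  \<open>nths \<pi> I\<close> lists the entries of \<open>\<pi>\<close> at the positions in \<open>I\<close>, in increasing order of position;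
  \<open>same_relative_order\<close> forces \<open>I\<close> to have as many elements as \<open>\<sigma>\<close> is long.
\<close>
definition occurrences :: "nat list \<Rightarrow> nat list \<Rightarrow> nat set set" where
  "occurrences \<sigma> \<pi> = {I. I \<subseteq> {..<length \<pi>} \<and> same_relative_order (nths \<pi> I) \<sigma>}"

definition total_occurrences_avoiding :: "nat list \<Rightarrow> nat list \<Rightarrow> nat \<Rightarrow> nat" where
  "total_occurrences_avoiding \<sigma> \<rho> n =
     (\<Sum>\<pi> | \<pi> \<in> permutations_of_set {1..n} \<and> avoids \<pi> \<rho>. card (occurrences \<sigma> \<pi>))"

text \<open>
  The formal power series \<open>(1 - 4x)\<^sup>c\<close> for a real exponent \<open>c\<close>: Newton's binomial series
  \<open>(1 + y)\<^sup>c\<close> at \<open>y = -4x\<close>.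
\<close>
definition one_minus_4x_powr :: "real \<Rightarrow> real fps" where
  "one_minus_4x_powr c = fps_binomial c oo (- (fps_const 4 * fps_X))"

text \<open>
  The numerator has constant term 0, so this division of formal power series is exact.
\<close>
definition catalan_gf :: "real fps" where
  "catalan_gf = (1 - one_minus_4x_powr (1/2)) / (fps_const 2 * fps_X)"

lemma one_minus_4x_powr_nth: "fps_nth (one_minus_4x_powr c) n = (- 4) ^ n * (c gchoose n)"
proof -
  have eq: "- (fps_const 4 * fps_X) = fps_const (- 4 :: real) * fps_X"
    by (simp flip: fps_const_neg)
  show ?thesis unfolding one_minus_4x_powr_def eq by simp
qed

lemma one_minus_4x_powr_1: "one_minus_4x_powr 1 = 1 - fps_const 4 * fps_X"
  by (simp add: one_minus_4x_powr_def fps_binomial_1 fps_compose_add_distrib)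

lemma one_minus_4x_powr_add:
  "one_minus_4x_powr (c + d) = one_minus_4x_powr c * one_minus_4x_powr d"
  by (simp add: one_minus_4x_powr_def fps_binomial_add_mult fps_compose_mult_distrib)

lemma catalan_gf_mult: "fps_const 2 * fps_X * catalan_gf = 1 - one_minus_4x_powr (1/2)"
proof -
  let ?f = "1 - one_minus_4x_powr (1/2)"
  have "?f = fps_const 2 * fps_X * (fps_const (1/2) * fps_shift 1 ?f)"
  proof (rule fps_ext)
    fix n
    show "fps_nth ?f n = fps_nth (fps_const 2 * fps_X * (fps_const (1/2) * fps_shift 1 ?f)) n"
      by (cases n) (simp_all add: mult.assoc one_minus_4x_powr_nth)
  qed
  hence "fps_const 2 * fps_X dvd ?f"
    by (rule dvdI)
  thus ?thesis
    unfolding catalan_gf_def by (rule dvd_mult_div_cancel)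
qed

lemma catalan_gf_nth: "fps_nth catalan_gf n = real ((2 * n) choose n) / real (n + 1)"
proof -
  have c: "fps_nth catalan_gf n = - ((- 4) ^ Suc n * ((1/2) gchoose Suc n)) / 2" for n
  proof -
    have "2 * fps_nth catalan_gf n = fps_nth (fps_const 2 * fps_X * catalan_gf) (Suc n)"
      by (simp add: mult.assoc)
    thus ?thesis by (simp add: catalan_gf_mult one_minus_4x_powr_nth)
  qed
  show ?thesis
  proof (induction n)
    case 0
    show ?case by (simp add: c)
  next
    case (Suc n)
    have "(1/2 - of_nat (Suc n)) * ((1/2) gchoose Suc n) =
            of_nat (Suc (Suc n)) * ((1/2::real) gchoose Suc (Suc n))"
      by (simp only: gbinomial_absorb_comp gbinomial_absorption)
    moreover have "1/2 - real (Suc n) = - 1/2 - real n"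
      by simp
    ultimately have g: "real (Suc (Suc n)) * ((1/2) gchoose Suc (Suc n)) =
        (- 1/2 - real n) * ((1/2) gchoose Suc n)"
      by simp
    have "real (Suc (Suc n)) * fps_nth catalan_gf (Suc n) =
            - ((- 4) ^ Suc (Suc n) * (real (Suc (Suc n)) * ((1/2) gchoose Suc (Suc n)))) / 2"
      by (simp add: c)
    also have "\<dots> = (4 * real n + 2) * fps_nth catalan_gf n"
      unfolding g c by (simp add: algebra_simps)
    finally have "real (Suc (Suc n)) * fps_nth catalan_gf (Suc n) = (4 * real n + 2) * fps_nth catalan_gf n" .
    moreover have "real (Suc n) * real ((2 * Suc n) choose Suc n) = (4 * real n + 2) * real ((2 * n) choose n)"
    proof -
      have 1: "Suc n * (Suc (Suc (2*n)) choose Suc n) = Suc (Suc (2*n)) * (Suc (2*n) choose n)"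
        by (rule Suc_times_binomial_eq[symmetric, simplified mult.commute])
      have 2: "Suc (2*n) * (2*n choose n) = (Suc (2*n) choose Suc n) * Suc n"
        by (rule Suc_times_binomial_eq)
      have 3: "(Suc (2*n) choose Suc n) = (Suc (2*n) choose n)"
        using binomial_symmetric[of n "Suc (2*n)"] by simp
      have "Suc n * (Suc (Suc (2*n)) choose Suc n) = 2 * ((Suc (2*n) choose n) * Suc n)"
        unfolding 1 by (simp del: binomial_Suc_Suc add: algebra_simps)
      also have "\<dots> = 2 * (Suc (2*n) * (2*n choose n))"
        by (simp only: 2 3)
      finally have "Suc n * (Suc (Suc (2*n)) choose Suc n) = (4 * n + 2) * (2*n choose n)"
        by simp
      hence "real (Suc n * (Suc (Suc (2*n)) choose Suc n)) = real ((4 * n + 2) * (2*n choose n))"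
        by (rule arg_cong)
      thus ?thesis by (simp del: binomial_Suc_Suc add: algebra_simps)
    qed
    moreover have "real (Suc n) * fps_nth catalan_gf n = real ((2 * n) choose n)"
      unfolding Suc by simp
    ultimately have "real (Suc n) * (real (Suc (Suc n)) * fps_nth catalan_gf (Suc n)) =
                       real (Suc n) * real ((2 * Suc n) choose Suc n)"
      by (metis mult.left_commute)
    hence "real (Suc (Suc n)) * fps_nth catalan_gf (Suc n) = real ((2 * Suc n) choose Suc n)"
      by (rule mult_left_cancel[THEN iffD1, rotated]) simp
    moreover have "real (Suc (Suc n)) \<noteq> 0"
      by simp
    ultimately have "fps_nth catalan_gf (Suc n) = real ((2 * Suc n) choose Suc n) / real (Suc (Suc n))"
      by (metis nonzero_mult_div_cancel_left)
    thus ?case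
      by (simp only: Suc_eq_plus1)
  qed
qed

end

theory Submission
  imports Defs
begin

text \<open>
  Build a 123-avoiding permutation by inserting the successive maxima. The new maximum \<open>m\<close> may be
  placed after the first \<open>v\<close> entries iff these are decreasing, that is, iff \<open>v\<close> is at most the length
  \<open>s\<close> of the maximal decreasing prefix. The new prefix length is \<open>s + 1\<close> if \<open>v = 0\<close> and \<open>v\<close> otherwise,
  and the occurrences of 213 that use \<open>m\<close> are given by the \<open>v choose 2\<close> pairs of entries before it.
  So the number of descendants \<open>k\<close> generations below a permutation, and the number of occurrences
  gained on the way, depend only on \<open>s\<close>. The generating function of the former is \<open>C\<^sup>s\<^sup>+\<^sup>1\<close>; that of
  the latter is \<open>C\<^sup>s\<^sup>+\<^sup>1\<close> times a cubic polynomial in \<open>s\<close>, whose value at \<open>s = 0\<close>, reached from the empty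
  permutation, is the theorem.
\<close>

section \<open>The maximal decreasing prefix under insertion of a new maximum\<close>

fun descent_prefix :: "'a::linorder list \<Rightarrow> nat" where
  "descent_prefix [] = 0"
| "descent_prefix [x] = 1"
| "descent_prefix (x # y # zs) = (if y < x then Suc (descent_prefix (y # zs)) else 1)"

text \<open>Replaces the recursion by the property used from here on: initial segments of a
  decreasing list decrease, so the admissible \<open>v\<close> form an interval starting at
  0.\<close>

lemma le_descent_prefix_iff:
  "v \<le> descent_prefix xs \<longleftrightarrow> v \<le> length xs \<and> sorted_wrt (>) (take v xs)"
proof (induction xs arbitrary: v rule: descent_prefix.induct)
  case (2 x)
  show ?case by (cases v) auto
next
  case (3 x y zs)
  show ?case
  proof (cases v)
    case (Suc w)
    show ?thesis
    proof (cases w)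
      case w: (Suc u)
      have "sorted_wrt (>) (take w (y # zs)) \<Longrightarrow> y < x \<Longrightarrow> \<forall>z\<in>set (take w (y # zs)). z < x"
        using w by auto
      then show ?thesis using 3[of w] Suc w by auto
    qed (simp add: Suc)
  qed simp
qed auto

lemma descent_prefix_eqI:
  assumes "v \<le> length xs" "sorted_wrt (>) (take v xs)"
    and "v < length xs \<Longrightarrow> \<not> sorted_wrt (>) (take (Suc v) xs)"
  shows "descent_prefix xs = v"
proof (rule antisym)
  show "descent_prefix xs \<le> v"
    using assms(3) le_descent_prefix_iff[of "Suc v" xs] by (auto simp: not_le Suc_le_eq)
  show "v \<le> descent_prefix xs"
    using assms(1,2) by (simp add: le_descent_prefix_iff)
qed

text \<open>Bridge from the shape of the prefix to patterns: an ascent followed by a larger entry is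
  a 123, and a descent followed by a larger entry is a 213.\<close>

lemma sorted_wrt_greater_iff_no_ascent:
  fixes xs :: "'a::linorder list"
  assumes "distinct xs"
  shows "sorted_wrt (>) xs \<longleftrightarrow> (\<nexists>a b. subseq [a, b] xs \<and> a < b)"
  using assms
proof (induction xs)
  case (Cons x xs)
  have "subseq [a, b] (x # xs) \<longleftrightarrow> subseq [a, b] xs \<or> a = x \<and> b \<in> set xs" for a b
    by (auto simp: subseq_singleton_left dest: subseq_Cons')
  then have "(\<nexists>a b. subseq [a, b] (x # xs) \<and> a < b) \<longleftrightarrow>
      (\<forall>b\<in>set xs. \<not> x < b) \<and> (\<nexists>a b. subseq [a, b] xs \<and> a < b)"
    by blast
  moreover have "(\<forall>b\<in>set xs. \<not> x < b) \<longleftrightarrow> (\<forall>b\<in>set xs. b < x)"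
    using Cons.prems by (auto simp: not_less le_less)
  ultimately show ?case using Cons by simp
qed simp

definition insert_at :: "nat \<Rightarrow> 'a \<Rightarrow> 'a list \<Rightarrow> 'a list" where
  "insert_at v m xs = take v xs @ m # drop v xs"

lemma descent_prefix_insert_0:
  assumes "\<And>x. x \<in> set xs \<Longrightarrow> x < m"
  shows "descent_prefix (insert_at 0 m xs) = Suc (descent_prefix xs)"
  using assms by (cases xs) (simp_all add: insert_at_def)

lemma descent_prefix_insert_pos:
  assumes "\<And>x. x \<in> set xs \<Longrightarrow> x < m" "0 < v" "v \<le> descent_prefix xs"
  shows "descent_prefix (insert_at v m xs) = v"
proof (rule descent_prefix_eqI)
  have v: "v \<le> length xs" "sorted_wrt (>) (take v xs)"
    using assms le_descent_prefix_iff by blast+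
  then show "v \<le> length (insert_at v m xs)" "sorted_wrt (>) (take v (insert_at v m xs))"
    by (auto simp: insert_at_def min_def)
  \<comment> \<open>Since \<open>0 < v\<close>, some entry precedes \<open>m\<close>; being smaller,
    it forms an ascent with \<open>m\<close>, so the decreasing prefix stops just before
    \<open>m\<close>.\<close>
  have "hd xs \<in> set (take v xs)" "hd xs < m"
    using v assms by (cases xs; cases v; auto)+
  moreover have "take (Suc v) (insert_at v m xs) = take v xs @ [m]"
    using v by (simp add: insert_at_def min_def)
  ultimately show "\<not> sorted_wrt (>) (take (Suc v) (insert_at v m xs))"
    using less_asym by (fastforce simp: sorted_wrt_append)
qed

section \<open>Subsequences of a list with one inserted entry\<close>

lemma set_mono_subseq: "subseq xs ys \<Longrightarrow> set xs \<subseteq> set ys"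
  by (auto simp: subseq_conv_nths dest: in_set_nthsD)

lemma distinct_subseq: "subseq xs ys \<Longrightarrow> distinct ys \<Longrightarrow> distinct xs"
  by (auto simp: subseq_conv_nths)

lemma subseq_insert_notin:
  assumes "m \<notin> set zs" "m \<notin> set xs" "m \<notin> set ys"
  shows "subseq zs (xs @ m # ys) \<longleftrightarrow> subseq zs (xs @ ys)"
proof
  assume "subseq zs (xs @ m # ys)"
  then have "subseq (filter (\<lambda>x. x \<noteq> m) zs) (filter (\<lambda>x. x \<noteq> m) (xs @ m # ys))"
    by (rule subseq_filter)
  moreover have "filter (\<lambda>x. x \<noteq> m) l = l" if "m \<notin> set l" for l
    using that by (induction l) auto
  ultimately show "subseq zs (xs @ ys)" using assms by simp
next
  have "subseq (xs @ ys) (xs @ m # ys)" by (intro list_emb_append_mono) auto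
  then show "subseq zs (xs @ ys) \<Longrightarrow> subseq zs (xs @ m # ys)"
    by (rule subseq_order.order_trans[rotated])
qed

text \<open>The final \<open>m\<close> can only match the single \<open>m\<close> of the longer
  list, so \<open>zs\<close> has to embed to the left of it.\<close>

lemma subseq_insert_last:
  assumes "m \<notin> set zs" "m \<notin> set xs" "m \<notin> set ys"
  shows "subseq (zs @ [m]) (xs @ m # ys) \<longleftrightarrow> subseq zs xs"
proof
  assume "subseq (zs @ [m]) (xs @ m # ys)"
  then obtain us vs where uv: "zs @ [m] = us @ vs" "subseq us xs" "subseq vs (m # ys)"
    by (rule subseq_appendE) auto
  have "m \<notin> set us" using uv(2) assms(2) set_mono_subseq by blast
  then obtain vs' where vs': "vs = vs' @ [m]" "zs = us @ vs'"
    using uv(1) by (cases vs rule: rev_cases) auto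
  \<comment> \<open>Otherwise \<open>vs\<close> starts with an entry of \<open>zs\<close>, which
    differs from \<open>m\<close>; then all of \<open>vs\<close>, including its last entry
    \<open>m\<close>, would embed in \<open>ys\<close>.\<close>
  have "vs' = []"
  proof (cases vs')
    case (Cons w ws)
    then have "subseq vs ys" using uv(3) vs' assms(1) by (auto split: if_splits)
    then show ?thesis using vs'(1) assms(3) set_mono_subseq by fastforce
  qed
  then show "subseq zs xs" using uv vs' by simp
next
  assume "subseq zs xs"
  then show "subseq (zs @ [m]) (xs @ m # ys)"
    by (intro list_emb_append_mono) auto
qed

section \<open>Patterns of length three\<close>

lemma same_relative_order_length3:
  "same_relative_order t [x, y, z] \<longleftrightarrow>
    (\<exists>a b c. t = [a, b, c] \<and> (a < b \<longleftrightarrow> x < y) \<and> (b < a \<longleftrightarrow> y < x) \<and> (a < c \<longleftrightarrow> x < z) \<and>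
      (c < a \<longleftrightarrow> z < x) \<and> (b < c \<longleftrightarrow> y < z) \<and> (c < b \<longleftrightarrow> z < y))"
proof (cases "length t = 3")
  case True
  then obtain a b c where t: "t = [a, b, c]"
    by (auto simp: numeral_3_eq_3 length_Suc_conv)
  show ?thesis
    unfolding t by (simp add: same_relative_order_def All_less_Suc) blast
qed (auto simp: same_relative_order_def)

lemma same_relative_order_123:
  "same_relative_order t [1, 2, 3] \<longleftrightarrow> (\<exists>a b c. t = [a, b, c] \<and> a < b \<and> b < c)"
  unfolding same_relative_order_length3 by (intro ex_cong1) auto

lemma same_relative_order_213:
  "same_relative_order t [2, 1, 3] \<longleftrightarrow> (\<exists>a b c. t = [b, a, c] \<and> a < b \<and> b < c)"
  unfolding same_relative_order_length3 by (subst ex_comm) (intro ex_cong1, auto)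

lemma avoids_123_iff:
  "avoids p [1, 2, 3] \<longleftrightarrow> (\<nexists>a b c. subseq [a, b, c] p \<and> a < b \<and> b < c)"
  unfolding avoids_def same_relative_order_123 by blast

section \<open>Counting occurrences as subsequences\<close>

text \<open>With distinct entries, values determine positions. Occurrences, defined as index sets,
  can therefore be counted as lists of values, which are easier to follow through an insertion that
  shifts positions.\<close>

lemma bij_betw_nths_subseqs:
  assumes "distinct xs"
  shows "bij_betw (nths xs) {I. I \<subseteq> {..<length xs}} {t. subseq t xs}"
proof (rule bij_betw_imageI)
  show "inj_on (nths xs) {I. I \<subseteq> {..<length xs}}"
  proof (rule inj_onI)
    fix I J assume IJ: "I \<in> {I. I \<subseteq> {..<length xs}}" "J \<in> {I. I \<subseteq> {..<length xs}}" "nths xs I = nths xs J"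
    have eq: "(!) xs ` K = set (nths xs K)" if "K \<subseteq> {..<length xs}" for K
      using that by (auto simp: set_nths)
    have "(!) xs ` I = (!) xs ` J" using IJ by (simp add: eq)
    moreover have "inj_on ((!) xs) {..<length xs}"
      using assms by (simp add: inj_on_nth)
    ultimately show "I = J" using IJ inj_on_image_eq_iff by blast
  qed
  show "nths xs ` {I. I \<subseteq> {..<length xs}} = {t. subseq t xs}"
  proof (intro equalityI subsetI)
    fix t assume "t \<in> {t. subseq t xs}"
    then obtain I where "t = nths xs I" by (auto simp: subseq_conv_nths)
    \<comment> \<open>\<open>nths\<close> ignores positions past the end, so the index set can be
      cut down to valid ones.\<close>
    moreover have "nths xs I = nths xs (I \<inter> {..<length xs})"
      by (simp add: nths_def) (rule arg_cong[where f = "map fst"], rule filter_cong, auto dest: set_zip_rightD)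
    ultimately show "t \<in> nths xs ` {I. I \<subseteq> {..<length xs}}" by blast
  qed (auto simp: subseq_conv_nths)
qed

lemma card_occurrences_distinct:
  assumes "distinct p"
  shows "card (occurrences s p) = card {t. subseq t p \<and> same_relative_order t s}"
proof -
  note bij = bij_betw_nths_subseqs[OF assms]
  have "bij_betw (nths p) (occurrences s p) {t. subseq t p \<and> same_relative_order t s}"
    by (rule bij_betw_subset[OF bij])
       (use bij in \<open>auto simp: occurrences_def bij_betw_def\<close>)
  then show ?thesis by (rule bij_betw_same_card)
qed

lemma card_subseq_length:
  assumes "distinct xs"
  shows "card {t. subseq t xs \<and> length t = k} = length xs choose k"
proof -
  note bij = bij_betw_nths_subseqs[OF assms]
  have len: "length (nths xs I) = card I" if "I \<subseteq> {..<length xs}" for I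
  proof -
    have "{i. i < length xs \<and> i \<in> I} = I" using that by auto
    then show ?thesis by (simp add: length_nths)
  qed
  have "bij_betw (nths xs) {I. I \<subseteq> {..<length xs} \<and> card I = k} {t. subseq t xs \<and> length t = k}"
  proof (rule bij_betw_subset[OF bij])
    have "subseq t xs \<longleftrightarrow> t \<in> nths xs ` {I. I \<subseteq> {..<length xs}}" for t
      using bij by (simp add: bij_betw_def)
    then show "nths xs ` {I. I \<subseteq> {..<length xs} \<and> card I = k} = {t. subseq t xs \<and> length t = k}"
      using len by auto
  qed auto
  then have "card {t. subseq t xs \<and> length t = k} = card {I. I \<subseteq> {..<length xs} \<and> card I = k}"
    by (rule bij_betw_same_card[symmetric])
  then show ?thesis by (simp add: n_subsets)
qed

text \<open>As the maximum, \<open>m\<close> can only play the 3, so the new occurrences come from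
  descents before it. The first \<open>v\<close> entries decrease, hence every pair of them
  contributes one.\<close>

lemma card_occurrences_213_insert:
  assumes "distinct p" "\<And>x. x \<in> set p \<Longrightarrow> x < m" "v \<le> descent_prefix p"
  shows "card (occurrences [2, 1, 3] (insert_at v m p)) = card (occurrences [2, 1, 3] p) + (v choose 2)"
proof -
  define xs ys where "xs = take v p" and "ys = drop v p"
  have p: "p = xs @ ys" by (simp add: xs_def ys_def)
  have xs: "length xs = v" "sorted_wrt (>) xs"
    using assms(3) by (auto simp: xs_def le_descent_prefix_iff)
  have d: "distinct xs" "m \<notin> set xs" "m \<notin> set ys" "distinct (xs @ m # ys)"
    using assms(1,2) unfolding p by auto
  define O3 where "O3 q = {t. subseq t q \<and> same_relative_order t [2, 1, 3]}" for q
  define E where "E = (\<lambda>t. t @ [m]) ` {t. subseq t xs \<and> length t = 2}"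
  have fin: "finite {t. subseq t q}" for q :: "nat list"
    by (rule finite_subset[of _ "set (subseqs q)"]) auto
  have "O3 (insert_at v m p) = O3 p \<union> E"
  proof (intro equalityI subsetI)
    fix t assume "t \<in> O3 (insert_at v m p)"
    then obtain a b c where t: "t = [b, a, c]" "a < b" "b < c" and s: "subseq t (xs @ m # ys)"
      unfolding O3_def same_relative_order_213 insert_at_def xs_def ys_def by blast
    have "c \<le> m" using set_mono_subseq[OF s] t assms(2) unfolding p by force
    show "t \<in> O3 p \<union> E"
    proof (cases "c = m")
      case True
      then have "subseq [b, a] xs"
        using s t d subseq_insert_last[of m "[b, a]" xs ys] by simp
      then show ?thesis using True t by (auto simp: E_def image_iff intro!: exI[of _ "[b, a]"])
    next
      case False
      then have "subseq t p"
        using s t d \<open>c \<le> m\<close> subseq_insert_notin[of m t xs ys] by (auto simp: p)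
      then show ?thesis using t unfolding O3_def same_relative_order_213 by auto
    qed
  next
    fix t assume "t \<in> O3 p \<union> E"
    then show "t \<in> O3 (insert_at v m p)"
    proof
      assume "t \<in> O3 p"
      moreover have "subseq p (xs @ m # ys)"
        unfolding p by (intro list_emb_append_mono) auto
      ultimately show ?thesis
        unfolding O3_def insert_at_def xs_def ys_def using subseq_order.order_trans by blast
    next
      assume "t \<in> E"
      then obtain b a where t: "t = [b, a] @ [m]" and ba: "subseq [b, a] xs"
        by (auto simp: E_def length_Suc_conv numeral_2_eq_2)
      have mem: "a \<in> set xs" "b \<in> set xs" using set_mono_subseq[OF ba] by auto
      have "distinct [b, a]" using ba d(1) distinct_subseq by blast
      moreover have "\<not> b < a"
        using ba xs(2) sorted_wrt_greater_iff_no_ascent[OF d(1)] by blast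
      ultimately have "a < b" by auto
      moreover have "b < m" using mem assms(2) p by auto
      moreover have "subseq t (xs @ m # ys)"
        unfolding t using subseq_insert_last[of m "[b, a]" xs ys] ba d mem by auto
      ultimately show ?thesis
        using t unfolding O3_def same_relative_order_213 insert_at_def xs_def ys_def by auto
    qed
  qed
  moreover have "O3 p \<inter> E = {}"
    using set_mono_subseq assms(2) by (fastforce simp: O3_def E_def)
  moreover have "finite (O3 p)" "finite E"
    unfolding O3_def E_def by (auto intro: finite_subset[OF _ fin])
  moreover have "card E = v choose 2"
    unfolding E_def using card_subseq_length[OF d(1), of 2] xs(1)
    by (subst card_image) (auto intro: inj_onI)
  moreover have "card (occurrences [2, 1, 3] q) = card (O3 q)" if "distinct q" for q
    unfolding O3_def by (rule card_occurrences_distinct[OF that])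
  moreover have "distinct (insert_at v m p)"
    using d(4) by (simp add: insert_at_def xs_def ys_def)
  ultimately show ?thesis
    using assms(1) by (simp add: card_Un_disjoint)
qed

section \<open>The generating tree of 123-avoiding permutations\<close>

definition av123 :: "nat \<Rightarrow> nat list set" where
  "av123 n = {p. p \<in> permutations_of_set {1..n} \<and> avoids p [1, 2, 3]}"

lemma av123_0: "av123 0 = {[]}"
  unfolding av123_def avoids_123_iff by auto

lemma av123D:
  assumes "p \<in> av123 n"
  shows "distinct p" "set p = {1..n}" "avoids p [1, 2, 3]"
  using assms by (auto simp: av123_def permutations_of_set_def)

text \<open>The new maximum can only play the 3, so it completes a 123 exactly when an ascent
  precedes it. Both directions matter below: one shows that children avoid 123, the other that every
  avoider has a parent.\<close>

lemma insert_at_in_av123_iff: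
  assumes p: "distinct p" "set p = {1..n}" and v: "v \<le> length p"
  shows "insert_at v (Suc n) p \<in> av123 (Suc n) \<longleftrightarrow> p \<in> av123 n \<and> v \<le> descent_prefix p"
proof -
  define xs ys where "xs = take v p" and "ys = drop v p"
  have pe: "p = xs @ ys" by (simp add: xs_def ys_def)
  have ins: "insert_at v (Suc n) p = xs @ Suc n # ys" by (simp add: insert_at_def xs_def ys_def)
  have d: "distinct xs" "Suc n \<notin> set xs" "Suc n \<notin> set ys"
    using p unfolding pe by (auto, force+)
  have perm: "insert_at v (Suc n) p \<in> permutations_of_set {1..Suc n}" "p \<in> permutations_of_set {1..n}"
    unfolding ins using p d unfolding pe by (auto simp: permutations_of_set_def atLeastAtMostSuc_conv)
  have "avoids (xs @ Suc n # ys) [1, 2, 3] \<longleftrightarrow> avoids p [1, 2, 3] \<and> sorted_wrt (>) xs"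
  proof (intro iffI conjI)
    assume av: "avoids (xs @ Suc n # ys) [1, 2, 3]"
    have "subseq p (xs @ Suc n # ys)" unfolding pe by (intro list_emb_append_mono) auto
    then show "avoids p [1, 2, 3]"
      using av unfolding avoids_def using subseq_order.order_trans by blast
    show "sorted_wrt (>) xs"
      unfolding sorted_wrt_greater_iff_no_ascent[OF d(1)]
    proof safe
      fix a b assume ab: "subseq [a, b] xs" "a < b"
      have "set [a, b] \<subseteq> set xs" using ab set_mono_subseq by blast
      then have "b \<in> set p" "Suc n \<notin> set [a, b]" using d by (auto simp: pe)
      then have "b < Suc n" using p by simp
      moreover have "subseq [a, b, Suc n] (xs @ Suc n # ys)"
        using subseq_insert_last[OF \<open>Suc n \<notin> set [a, b]\<close> d(2,3)] ab by simp
      ultimately show False using av ab unfolding avoids_123_iff by blast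
    qed
  next
    assume *: "avoids p [1, 2, 3] \<and> sorted_wrt (>) xs"
    show "avoids (xs @ Suc n # ys) [1, 2, 3]"
      unfolding avoids_123_iff
    proof safe
      fix a b c assume abc: "subseq [a, b, c] (xs @ Suc n # ys)" "a < b" "b < c"
      have "c = Suc n \<or> c \<in> set p" using set_mono_subseq[OF abc(1)] by (auto simp: pe)
      then have "c \<le> Suc n" using p by auto
      show False
      proof (cases "c = Suc n")
        case True
        then have "Suc n \<notin> set [a, b]" using abc by auto
        then have "subseq [a, b] xs"
          using subseq_insert_last[OF _ d(2,3), of "[a, b]"] abc(1) True by simp
        then show False using * abc sorted_wrt_greater_iff_no_ascent[OF d(1)] by blast
      next
        case False
        then have "Suc n \<notin> set [a, b, c]" using abc \<open>c \<le> Suc n\<close> by auto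
        then have "subseq [a, b, c] p"
          using subseq_insert_notin[OF _ d(2,3)] abc(1) by (simp add: pe)
        then show False using * abc unfolding avoids_123_iff by blast
      qed
    qed
  qed
  then show ?thesis
    using perm v by (simp add: av123_def ins le_descent_prefix_iff xs_def)
qed

lemma insert_at_inject:
  assumes "m \<notin> set p" "m \<notin> set q" "v \<le> length p" "w \<le> length q"
    and "insert_at v m p = insert_at w m q"
  shows "v = w \<and> p = q"
proof -
  have "m \<notin> set (take v p)" "m \<notin> set (take w q)" "m \<notin> set (drop v p)" "m \<notin> set (drop w q)"
    using assms in_set_takeD in_set_dropD by metis+
  then have "take v p = take w q" "drop v p = drop w q"
    using assms(5) by (auto simp: insert_at_def append_Cons_eq_iff)
  then show ?thesis
    using assms(3,4) by (metis append_take_drop_id length_take min.absorb2)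
qed

text \<open>The inverse deletes the maximum and records its position. Thus a permutation with
  decreasing prefix of length \<open>s\<close> has \<open>s + 1\<close> children.\<close>

lemma bij_betw_insert_max:
  "bij_betw (\<lambda>(p, v). insert_at v (Suc n) p) (SIGMA p:av123 n. {..descent_prefix p}) (av123 (Suc n))"
proof (rule bij_betw_imageI)
  have le: "v \<le> length p" if "v \<le> descent_prefix p" for v and p :: "nat list"
    using that by (simp add: le_descent_prefix_iff)
  show "inj_on (\<lambda>(p, v). insert_at v (Suc n) p) (SIGMA p:av123 n. {..descent_prefix p})"
  proof (rule inj_onI)
    fix a b
    assume ab: "a \<in> (SIGMA p:av123 n. {..descent_prefix p})" "b \<in> (SIGMA p:av123 n. {..descent_prefix p})"
      and eq_ab: "(case a of (p, v) \<Rightarrow> insert_at v (Suc n) p) = (case b of (p, v) \<Rightarrow> insert_at v (Suc n) p)"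
    obtain p v q w where a: "a = (p, v)" and b: "b = (q, w)"
      by (cases a, cases b)
    have pq: "p \<in> av123 n" "q \<in> av123 n" and vw: "v \<le> descent_prefix p" "w \<le> descent_prefix q"
      and eq: "insert_at v (Suc n) p = insert_at w (Suc n) q"
      using ab eq_ab by (auto simp: a b)
    have "Suc n \<notin> set p" "Suc n \<notin> set q" using pq av123D(2) by auto
    then show "a = b"
      using insert_at_inject[OF _ _ le le eq] vw by (simp add: a b)
  qed
  show "(\<lambda>(p, v). insert_at v (Suc n) p) ` (SIGMA p:av123 n. {..descent_prefix p}) = av123 (Suc n)"
  proof (intro equalityI subsetI)
    fix q assume q: "q \<in> av123 (Suc n)"
    then have "Suc n \<in> set q" using av123D(2) by force
    then obtain xs ys where xy: "q = xs @ Suc n # ys" by (meson split_list)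
    then have qi: "q = insert_at (length xs) (Suc n) (xs @ ys)" by (simp add: insert_at_def)
    have d: "distinct (xs @ ys)" "set (xs @ ys) = {1..n}"
    proof -
      have "distinct q" "set q = insert (Suc n) {1..n}"
        using av123D(1,2)[OF q] by (simp_all add: atLeastAtMostSuc_conv)
      moreover have "set (xs @ ys) = set q - {Suc n}" "distinct (xs @ ys)"
        using \<open>distinct q\<close> by (auto simp: xy)
      ultimately show "distinct (xs @ ys)" "set (xs @ ys) = {1..n}" by simp_all
    qed
    have "xs @ ys \<in> av123 n \<and> length xs \<le> descent_prefix (xs @ ys)"
      using insert_at_in_av123_iff[OF d, of "length xs"] q unfolding qi[symmetric] by simp
    then show "q \<in> (\<lambda>(p, v). insert_at v (Suc n) p) ` (SIGMA p:av123 n. {..descent_prefix p})"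
      using qi by (intro image_eqI[of _ _ "(xs @ ys, length xs)"]) auto
  next
    fix q assume "q \<in> (\<lambda>(p, v). insert_at v (Suc n) p) ` (SIGMA p:av123 n. {..descent_prefix p})"
    then obtain p v where p: "p \<in> av123 n" and v: "v \<le> descent_prefix p"
      and q: "q = insert_at v (Suc n) p" by auto
    show "q \<in> av123 (Suc n)"
      using insert_at_in_av123_iff[OF av123D(1,2)[OF p] le[OF v]] p v q by simp
  qed
qed

lemma finite_av123: "finite (av123 n)"
  by (simp add: av123_def)

section \<open>Summing over the tree\<close>

lemma sum_av123_Suc:
  fixes h :: "nat list \<Rightarrow> real"
  shows "sum h (av123 (Suc n)) = (\<Sum>p\<in>av123 n. \<Sum>v\<le>descent_prefix p. h (insert_at v (Suc n) p))"
  by (simp add: sum.reindex_bij_betw[OF bij_betw_insert_max, symmetric] sum.Sigma finite_av123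
      case_prod_unfold)

text \<open>
  \<open>D s\<close> counts the descendants of a permutation with decreasing prefix of length \<open>s\<close> by generation,
  and \<open>W s\<close> the occurrences of 213 they have in addition to those of their ancestor.
\<close>
lemma sum_occurrences_213_descendants:
  fixes D W :: "nat \<Rightarrow> real fps"
  assumes D: "\<And>s. D s = 1 + fps_X * (D (Suc s) + (\<Sum>v=1..s. D v))"
    and W: "\<And>s. W s = fps_X * (W (Suc s) + (\<Sum>v=1..s. W v + of_nat (v choose 2) * D v))"
  shows "(\<Sum>p\<in>av123 (n + k). real (card (occurrences [2, 1, 3] p))) =
    (\<Sum>p\<in>av123 n. real (card (occurrences [2, 1, 3] p)) * fps_nth (D (descent_prefix p)) k
                   + fps_nth (W (descent_prefix p)) k)"
\<comment> \<open>The step peels off the generation next to the root, where \<open>D\<close> and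
  \<open>W\<close> have their recurrences, so the hypothesis is applied at
  \<open>Suc n\<close>.\<close>
proof (induction k arbitrary: n)
  case 0
  have "fps_nth (D s) 0 = 1" "fps_nth (W s) 0 = 0" for s
    by (subst D W, simp)+
  then show ?case by simp
next
  case (Suc k)
  define occ where "occ p = real (card (occurrences [2, 1, 3] p))" for p
  have of_nat_nth: "fps_nth (of_nat c * f) j = real c * fps_nth f j" for c j and f :: "real fps"
    by (simp flip: fps_of_nat)
  have D': "fps_nth (D s) (Suc k) = fps_nth (D (Suc s)) k + (\<Sum>v=1..s. fps_nth (D v) k)" for s
    by (subst D) (simp add: fps_sum_nth)
  \<comment> \<open>All descendants of a child inherit the \<open>v choose 2\<close> occurrences
    gained at its birth, hence the factor \<open>D v\<close>.\<close>
  have W': "fps_nth (W s) (Suc k) = fps_nth (W (Suc s)) k +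
      (\<Sum>v=1..s. fps_nth (W v) k + real (v choose 2) * fps_nth (D v) k)" for s
    by (subst W) (simp add: fps_sum_nth of_nat_nth)
  have step: "(\<Sum>v\<le>descent_prefix p. occ (insert_at v (Suc n) p) * fps_nth (D (descent_prefix (insert_at v (Suc n) p))) k
                + fps_nth (W (descent_prefix (insert_at v (Suc n) p))) k)
      = occ p * fps_nth (D (descent_prefix p)) (Suc k) + fps_nth (W (descent_prefix p)) (Suc k)"
    if p: "p \<in> av123 n" for p
  proof -
    have lt: "x < Suc n" if "x \<in> set p" for x using that av123D(2)[OF p] by auto
    have occ: "occ (insert_at v (Suc n) p) = occ p + real (v choose 2)" if "v \<le> descent_prefix p" for v
      using card_occurrences_213_insert[OF av123D(1)[OF p] lt that] by (simp add: occ_def)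
    let ?f = "\<lambda>v. occ (insert_at v (Suc n) p) * fps_nth (D (descent_prefix (insert_at v (Suc n) p))) k
                + fps_nth (W (descent_prefix (insert_at v (Suc n) p))) k"
    \<comment> \<open>Insertion at the front is separate: it lengthens the prefix by one and gains
      nothing, whereas \<open>v \<ge> 1\<close> sets the prefix length to \<open>v\<close>.\<close>
    have "(\<Sum>v\<le>descent_prefix p. ?f v) = ?f 0 + (\<Sum>v=1..descent_prefix p. ?f v)"
      by (simp add: sum.atLeast_Suc_atMost atMost_atLeast0)
    also have "?f 0 = occ p * fps_nth (D (Suc (descent_prefix p))) k + fps_nth (W (Suc (descent_prefix p))) k"
      using occ[of 0] descent_prefix_insert_0[OF lt] by simp
    also have "(\<Sum>v=1..descent_prefix p. ?f v) =
        (\<Sum>v=1..descent_prefix p. (occ p + real (v choose 2)) * fps_nth (D v) k + fps_nth (W v) k)"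
      using occ descent_prefix_insert_pos[OF lt] by (intro sum.cong) auto
    finally show ?thesis
      by (simp add: D' W' sum.distrib sum_distrib_left algebra_simps)
  qed
  have "(\<Sum>p\<in>av123 (n + Suc k). occ p) = (\<Sum>p\<in>av123 (Suc n + k). occ p)" by simp
  also have "\<dots> = (\<Sum>p\<in>av123 (Suc n). occ p * fps_nth (D (descent_prefix p)) k + fps_nth (W (descent_prefix p)) k)"
    unfolding occ_def by (rule Suc.IH)
  also have "\<dots> = (\<Sum>p\<in>av123 n. occ p * fps_nth (D (descent_prefix p)) (Suc k) + fps_nth (W (descent_prefix p)) (Suc k))"
    unfolding sum_av123_Suc by (rule sum.cong[OF refl step])
  finally show ?case by (simp add: occ_def)
qed

section \<open>Solving the recurrences\<close>

text \<open>Supplies \<open>D s = c ^ Suc s\<close>. The right-hand sides for \<open>s + 1\<close>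
  and \<open>s\<close> differ by \<open>x * c ^ (s + 3)\<close>, which the quadratic equation turns
  into \<open>c ^ (s + 2) - c ^ (s + 1)\<close>.\<close>

lemma power_recurrence:
  fixes x c :: "'a::comm_ring_1"
  assumes "x * c\<^sup>2 = c - 1"
  shows "c ^ Suc s = 1 + x * (c ^ Suc (Suc s) + (\<Sum>v=1..s. c ^ Suc v))"
proof (induction s)
  case 0
  then show ?case using assms by (simp add: power2_eq_square)
next
  case (Suc s)
  have "x * c ^ Suc (Suc (Suc s)) = (x * c\<^sup>2) * c ^ Suc s"
    by (simp add: power2_eq_square algebra_simps)
  then have "x * c ^ Suc (Suc (Suc s)) = c ^ Suc (Suc s) - c ^ Suc s"
    unfolding assms by (simp add: algebra_simps)
  then show ?case using Suc by (simp add: distrib_left del: power_Suc)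
qed

text \<open>
  Substituting \<open>W s = c\<^sup>s\<^sup>+\<^sup>1 p(s)\<close> and \<open>x c\<^sup>2 = c - 1\<close> in the recurrence gives, for the difference
  \<open>g(s) = p(s+1) - p(s)\<close>, the equation \<open>(2 - c) g(s) - (g(s) - g(s-1)) = x c (s choose 2)\<close> with
  \<open>p(-1) = 0\<close>. Comparing coefficients for \<open>g(s) = \<alpha> (s choose 2) + \<beta> s + \<gamma>\<close>, and using \<open>2 - c = r c\<close> and
  \<open>1/c = 1 - x c\<close>, yields the constants below; \<open>p(0) = g(-1) = \<alpha> - \<beta> + \<gamma>\<close>.
\<close>
lemma weighted_recurrence:
  fixes x c r R :: "'a::comm_ring_1"
  assumes c: "x * c\<^sup>2 = c - 1" and r: "r = 1 - 2 * x * c" and R: "r * R = 1"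
  defines "\<alpha> \<equiv> x * R" and "\<beta> \<equiv> x * R\<^sup>2 * (1 - x * c)"
  defines "\<gamma> \<equiv> (\<beta> - \<alpha>) * R * (1 - x * c)"
  defines "g \<equiv> \<lambda>j. \<alpha> * of_nat (j choose 2) + \<beta> * of_nat j + \<gamma>"
  defines "W \<equiv> \<lambda>s. c ^ Suc s * (\<alpha> - \<beta> + \<gamma> + (\<Sum>j<s. g j))"
  shows "W s = x * (W (Suc s) + (\<Sum>v=1..s. W v + of_nat (v choose 2) * c ^ Suc v))"
    and "W 0 = x ^ 3 * c ^ 3 * R ^ 3"
proof -
  have K: "c * (1 - x * c) = 1" using c by (simp add: algebra_simps power2_eq_square)
  have "r * c = c - 2 * (x * c\<^sup>2)" unfolding r by (simp add: algebra_simps power2_eq_square)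
  then have rc: "r * c = 2 - c" unfolding c by (simp add: algebra_simps)
  have a: "(2 - c) * \<alpha> = x * c"
    unfolding rc[symmetric] \<alpha>_def using R by (metis (no_types, lifting) mult.assoc mult.commute mult_1)
  have b: "(2 - c) * \<beta> = \<alpha>"
  proof -
    have "(2 - c) * \<beta> = x * R * (r * R) * (c * (1 - x * c))"
      unfolding rc[symmetric] \<beta>_def by (simp add: power2_eq_square algebra_simps)
    then show ?thesis by (simp add: K R \<alpha>_def)
  qed
  have gam: "(2 - c) * \<gamma> = \<beta> - \<alpha>"
  proof -
    have "(2 - c) * \<gamma> = (\<beta> - \<alpha>) * (r * R) * (c * (1 - x * c))"
      unfolding rc[symmetric] \<gamma>_def by (simp add: algebra_simps)
    then show ?thesis by (simp add: K R)
  qed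
  have g_Suc: "g (Suc j) = g j + \<alpha> * of_nat j + \<beta>" for j
    by (simp add: g_def numeral_2_eq_2 algebra_simps)
  have g_eq: "(2 - c) * g (Suc j) = \<alpha> * of_nat j + \<beta> + x * c * of_nat (Suc j choose 2)" for j
  proof -
    have "(2 - c) * g (Suc j) = ((2 - c) * \<alpha>) * of_nat (Suc j choose 2) + ((2 - c) * \<beta>) * of_nat (Suc j) + (2 - c) * \<gamma>"
      unfolding g_def by (simp only: algebra_simps)
    then show ?thesis unfolding a b gam by (simp add: algebra_simps)
  qed
  show "W s = x * (W (Suc s) + (\<Sum>v=1..s. W v + of_nat (v choose 2) * c ^ Suc v))"
  \<comment> \<open>Subtracting the recurrence at \<open>s\<close> from the one at
    \<open>s + 1\<close> cancels the sums and leaves a relation between three consecutive values of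
    \<open>W\<close>.\<close>
  proof (induction s)
    case 0
    have g0: "g 0 = \<gamma>" by (simp add: g_def numeral_2_eq_2)
    have "x * W (Suc 0) = (x * c\<^sup>2) * (\<alpha> - \<beta> + 2 * \<gamma>)"
      by (simp add: W_def g0 power2_eq_square algebra_simps)
    also have "\<dots> = c * (\<alpha> - \<beta> + \<gamma>) - (\<alpha> - \<beta>) - (2 - c) * \<gamma>"
      unfolding c by (simp add: algebra_simps)
    also have "\<dots> = W 0" unfolding gam by (simp add: W_def algebra_simps)
    finally show ?case by simp
  next
    case (Suc s)
    define P where "P = \<alpha> - \<beta> + \<gamma> + (\<Sum>j<s. g j)"
    have "x * W (Suc (Suc s)) = (x * c\<^sup>2) * (c ^ Suc s * (P + g s + g (Suc s)))"
      by (simp add: W_def P_def power2_eq_square algebra_simps)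
    also have "\<dots> = c ^ Suc s * ((c - 1) * (P + g s + g (Suc s)))"
      unfolding c by (simp add: algebra_simps)
    \<comment> \<open>Arranged to isolate \<open>(2 - c) * g (Suc s)\<close>: by \<open>g_eq\<close>
      it absorbs the difference \<open>g (Suc s) - g s\<close> and leaves only the binomial
      term.\<close>
    also have "(c - 1) * (P + g s + g (Suc s)) = c * (P + g s) - P - g s + g (Suc s) - (2 - c) * g (Suc s)"
      by (simp add: algebra_simps)
    also have "\<dots> = c * (P + g s) - P - x * c * of_nat (Suc s choose 2)"
      unfolding g_eq unfolding g_Suc by simp
    also have "c ^ Suc s * \<dots> = W (Suc s) - W s - x * of_nat (Suc s choose 2) * c ^ Suc (Suc s)"
      by (simp add: W_def P_def algebra_simps)
    finally have "W (Suc s) = W s + x * W (Suc (Suc s)) + x * of_nat (Suc s choose 2) * c ^ Suc (Suc s)"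
      by (simp only: algebra_simps)
    moreover have "x * (W (Suc s) + (\<Sum>v=1..s. W v + of_nat (v choose 2) * c ^ Suc v)) = W s"
      using Suc by simp
    ultimately show ?case
      by (simp add: distrib_left add.assoc mult.assoc del: power_Suc binomial_Suc_Suc)
         (simp add: algebra_simps del: power_Suc binomial_Suc_Suc)
  qed
  define K where "K = 1 - x * c"
  have RK: "R * K * (2 - c) = 1"
  proof -
    have "R * K * (2 - c) = (r * R) * (c * K)" unfolding rc[symmetric] by (simp add: algebra_simps)
    then show ?thesis by (simp add: K_def K R)
  qed
  have d: "\<alpha> - \<beta> = - (x\<^sup>2 * c\<^sup>2 * R\<^sup>2 * K)"
  proof -
    have "\<alpha> - \<beta> = (2 - c) * \<beta> - \<beta>" using b by simp
    also have "\<dots> = - (c - 1) * \<beta>" by (simp add: algebra_simps)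
    finally show ?thesis unfolding c[symmetric] \<beta>_def K_def by (simp add: power2_eq_square algebra_simps)
  qed
  \<comment> \<open>Multiplying \<open>\<alpha> - \<beta>\<close> by
    \<open>R * K * (2 - c) = 1\<close> exposes the factor shared with
    \<open>\<gamma> = - (\<alpha> - \<beta>) * R * K\<close>. What remains is
    \<open>1 - c = - x * c\<^sup>2\<close>.\<close>
  have "\<alpha> - \<beta> + \<gamma> = (\<alpha> - \<beta>) * (R * K * (2 - c)) - (\<alpha> - \<beta>) * R * K"
    unfolding RK by (simp add: \<gamma>_def K_def algebra_simps)
  also have "\<dots> = (\<alpha> - \<beta>) * R * K * - (c - 1)" by (simp add: algebra_simps)
  also have "\<dots> = x ^ 3 * c ^ 2 * R ^ 3 * (c * K)\<^sup>2"
    unfolding d unfolding c[symmetric] by (simp add: power2_eq_square power3_eq_cube algebra_simps)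
  finally have "\<alpha> - \<beta> + \<gamma> = x ^ 3 * c ^ 2 * R ^ 3" using K by (simp add: K_def)
  then show "W 0 = x ^ 3 * c ^ 3 * R ^ 3"
    by (simp add: W_def power2_eq_square power3_eq_cube algebra_simps)
qed

section \<open>The Catalan series and the closed forms\<close>

lemma one_minus_4x_powr_0: "one_minus_4x_powr 0 = 1"
  by (simp add: one_minus_4x_powr_def)

text \<open>The series \<open>r = 1 - 2 * x * c\<close> is a square root of
  \<open>1 - 4 * x\<close>; expanding its square and cancelling \<open>4 * x\<close> gives the
  equation.\<close>

lemma catalan_gf_quadratic: "fps_X * catalan_gf\<^sup>2 = catalan_gf - 1"
proof -
  define x :: "real fps" where "x = fps_X"
  define c where "c = catalan_gf"
  define r where "r = one_minus_4x_powr (1/2)"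
  have r: "r = 1 - 2 * x * c"
    using catalan_gf_mult by (simp add: x_def c_def r_def algebra_simps fps_numeral_fps_const)
  have "r * r = 1 - 4 * x"
    using one_minus_4x_powr_add[of "1/2" "1/2"] one_minus_4x_powr_1
    by (simp add: r_def x_def fps_numeral_fps_const)
  then have "(4 * x) * (x * c\<^sup>2) = (4 * x) * (c - 1)"
    unfolding r by (simp add: power2_eq_square algebra_simps)
  moreover have "4 * x \<noteq> 0" by (simp add: x_def)
  ultimately show ?thesis unfolding x_def c_def using mult_left_cancel by blast
qed

theorem theorem2p9:
  shows "Abs_fps (\<lambda>n. real (total_occurrences_avoiding [2, 1, 3] [1, 2, 3] n)) =
           fps_X ^ 3 * catalan_gf ^ 3 / one_minus_4x_powr (3/2) \<and>
         fps_X ^ 3 * catalan_gf ^ 3 / one_minus_4x_powr (3/2) =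
           (fps_X - 1) / (fps_const 2 * (1 - fps_const 4 * fps_X)) -
           (fps_const 3 * fps_X - 1) / (fps_const 2 * one_minus_4x_powr (3/2))"
proof -
  define x :: "real fps" where "x = fps_X"
  define c where "c = catalan_gf"
  define r where "r = one_minus_4x_powr (1/2)"
  \<comment> \<open>\<open>R\<close> inverts \<open>r\<close>, so quotients by powers of
    \<open>r\<close> become products and the identities can be checked by ring arithmetic.\<close>
  define R where "R = one_minus_4x_powr (- 1/2)"
  have c: "x * c\<^sup>2 = c - 1" unfolding x_def c_def by (rule catalan_gf_quadratic)
  have r: "r = 1 - 2 * x * c"
    using catalan_gf_mult by (simp add: x_def c_def r_def algebra_simps fps_numeral_fps_const)
  have R: "r * R = 1"
    using one_minus_4x_powr_add[of "1/2" "-1/2"] by (simp add: r_def R_def one_minus_4x_powr_0)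
  have r2: "1 - fps_const 4 * fps_X = r\<^sup>2"
    using one_minus_4x_powr_add[of "1/2" "1/2"] one_minus_4x_powr_1
    by (simp add: r_def power2_eq_square)
  have r3: "one_minus_4x_powr (3/2) = r ^ 3"
    using one_minus_4x_powr_add[of 1 "1/2"] one_minus_4x_powr_1 r2
    by (simp add: r_def power2_eq_square power3_eq_cube)
  have nz: "r \<noteq> 0" using R by auto
  have div_eqI: "f / h = k" if "f = k * h" "h \<noteq> 0" for f h k :: "real fps"
    using that by simp
  have R3: "R ^ 3 * r ^ 3 = 1" "R\<^sup>2 * r\<^sup>2 = 1"
    using R by (simp_all add: mult.commute flip: power_mult_distrib)
  have main: "x ^ 3 * c ^ 3 / r ^ 3 = x ^ 3 * c ^ 3 * R ^ 3"
    using R3 nz by (intro div_eqI) (auto simp: mult.assoc)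
  note rec = weighted_recurrence[OF c r R]
  \<comment> \<open>The root is the empty permutation, with prefix length 0 and no occurrence of
    213, so only the coefficient of \<open>W 0\<close> will remain.\<close>
  note desc = sum_occurrences_213_descendants[OF
      power_recurrence[OF c, unfolded x_def] rec(1)[unfolded x_def], where n = 0]
  have "Abs_fps (\<lambda>n. real (total_occurrences_avoiding [2, 1, 3] [1, 2, 3] n)) = x ^ 3 * c ^ 3 * R ^ 3"
  proof (rule fps_ext)
    fix k
    have "occurrences [2, 1, 3] [] = {}"
      by (auto simp: occurrences_def same_relative_order_def)
    then have "(\<Sum>p\<in>av123 k. real (card (occurrences [2, 1, 3] p))) = fps_nth (x ^ 3 * c ^ 3 * R ^ 3) k"
      using desc[of k] rec(2) by (simp add: av123_0 x_def)
    then show "fps_nth (Abs_fps (\<lambda>n. real (total_occurrences_avoiding [2, 1, 3] [1, 2, 3] n))) k =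
        fps_nth (x ^ 3 * c ^ 3 * R ^ 3) k"
      by (simp add: total_occurrences_avoiding_def av123_def)
  qed
  moreover have "x ^ 3 * c ^ 3 * R ^ 3 = (x - 1) / (2 * r\<^sup>2) - (3 * x - 1) / (2 * r ^ 3)"
  proof -
    define h :: "real fps" where "h = fps_const (1/2)"
    have h: "2 * h = 1" by (simp add: h_def fps_numeral_fps_const)
    have "(x - 1) / (2 * r\<^sup>2) = h * (x - 1) * R\<^sup>2"
    proof (rule div_eqI)
      have "h * (x - 1) * R\<^sup>2 * (2 * r\<^sup>2) = (2 * h) * (x - 1) * (R\<^sup>2 * r\<^sup>2)" by (simp only: ac_simps)
      then show "x - 1 = h * (x - 1) * R\<^sup>2 * (2 * r\<^sup>2)" by (simp add: h R3)
    qed (use nz in simp)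
    moreover have "(3 * x - 1) / (2 * r ^ 3) = h * (3 * x - 1) * R ^ 3"
    proof (rule div_eqI)
      have "h * (3 * x - 1) * R ^ 3 * (2 * r ^ 3) = (2 * h) * (3 * x - 1) * (R ^ 3 * r ^ 3)" by (simp only: ac_simps)
      then show "3 * x - 1 = h * (3 * x - 1) * R ^ 3 * (2 * r ^ 3)" by (simp add: h R3)
    qed (use nz in simp)
    moreover have "x ^ 3 * c ^ 3 * R ^ 3 = h * (x - 1) * R\<^sup>2 - h * (3 * x - 1) * R ^ 3"
    proof -
      \<comment> \<open>Grouped so that \<open>x * c\<^sup>2 = c - 1\<close>, used twice, and
        \<open>2 * x * c = 1 - r\<close> reduce the cubic in \<open>c\<close> to an expression
        linear in \<open>r\<close>.\<close>
      have "2 * (x ^ 3 * c ^ 3) = 2 * x * (x * c) * (x * c\<^sup>2)"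
        by (simp add: power2_eq_square power3_eq_cube)
      also have "\<dots> = 2 * x * (x * c\<^sup>2) - 2 * x * (x * c)"
        unfolding c by (subst right_diff_distrib) (simp add: c[symmetric] power2_eq_square algebra_simps)
      also have "\<dots> = (x - 1) * r - (3 * x - 1)"
        unfolding c r by (simp add: algebra_simps)
      finally have e: "2 * (x ^ 3 * c ^ 3) = (x - 1) * r - (3 * x - 1)" .
      have "x ^ 3 * c ^ 3 * R ^ 3 = h * (2 * (x ^ 3 * c ^ 3)) * R ^ 3"
        using h by (simp add: mult.assoc[symmetric] mult.commute[of h 2])
      also have "\<dots> = h * (x - 1) * (R\<^sup>2 * (r * R)) - h * (3 * x - 1) * R ^ 3"
        unfolding e by (simp add: power2_eq_square power3_eq_cube algebra_simps)
      finally show ?thesis by (simp add: R)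
    qed
    ultimately show ?thesis by simp
  qed
  ultimately show ?thesis
    using main by (simp add: r2 r3 x_def c_def fps_numeral_fps_const)
qed

end
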